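(* Let $P$ be a countable poset. Then the geometric realization $|P|$ is uniformly locally contractible: for each $\varepsilon>0$ there exists a $\delta>0$ such that for every metric space $X$, every two uniformly continuous maps $f,g\colon X\to|P|$ with $d(f(x),g(x))<\delta$ for all $x\in X$ are uniformly $\varepsilon$-homotopic with values in $|P|$.
   Context: Geometric realization: for a poset $P$, let $[0,1]^P$ be the set of all functions $P\to[0,1]$ with the metric $d(f,g)=\sup_{s\in P}|f(s)-g(s)|$. Each $p\in P$ is identified with the characteristic function of $\{q\in P: q\le p\}$. Then $|P|\subset[0,1]^P$ is the union of the convex hulls of all nonempty finite chains of $P$, with the metric $d$. Two maps $f,g\colon X\to|P|$ are uniformly $\varepsilon$-homotopic if there is a uniformly continuous map $H\colon X\times[0,1]\to|P|$ with $H(x,0)=f(x)$, $H(x,1)=g(x)$ and $d(H(x,t),H(x,0))\le\varepsilon$ for all $x\in X$ and $t\in[0,1]$. *)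

theory Defs
  imports "HOL-Analysis.Analysis"
begin

text \<open>
  A poset is a carrier \<open>P\<close> with \<open>partial_order_on P r\<close>, where \<open>(q, p) \<in> r\<close> means \<open>q \<le> p\<close>.
  Functions on \<open>P\<close> are extensional (\<open>undefined\<close> off \<open>P\<close>), so that they are equal exactly when they
  agree on \<open>P\<close>.
\<close>

definition cube :: "'a set \<Rightarrow> ('a \<Rightarrow> real) set" where
  "cube P = P \<rightarrow>\<^sub>E {0..1}"

text \<open>
  The inserted \<open>0\<close> matters only for \<open>P = {}\<close>: the supremum of the empty set of reals is unspecified.
  The value \<open>0\<close> off the cube is needed because \<^locale>\<open>Metric_space\<close> requires a distance that is
  nonnegative on the whole type.
\<close>

definition sup_dist :: "'a set \<Rightarrow> ('a \<Rightarrow> real) \<Rightarrow> ('a \<Rightarrow> real) \<Rightarrow> real" where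
  "sup_dist P f g =
     (if f \<in> cube P \<and> g \<in> cube P then Sup (insert 0 ((\<lambda>s. \<bar>f s - g s\<bar>) ` P)) else 0)"

definition cube_metric :: "'a set \<Rightarrow> ('a \<Rightarrow> real) metric" where
  "cube_metric P = metric (cube P, sup_dist P)"

definition vertex :: "'a set \<Rightarrow> ('a \<times> 'a) set \<Rightarrow> 'a \<Rightarrow> 'a \<Rightarrow> real" where
  "vertex P r p = restrict (indicator {q. (q, p) \<in> r}) P"

text \<open>
  The library's convex hull needs a real vector space type, which function types are not; for the
  finite vertex set of a chain \<open>C\<close> the hull is the set of all convex combinations.
\<close>

definition simplex_of :: "'a set \<Rightarrow> ('a \<times> 'a) set \<Rightarrow> 'a set \<Rightarrow> ('a \<Rightarrow> real) set" where
  "simplex_of P r C =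
     {\<lambda>s\<in>P. \<Sum>p\<in>C. c p * vertex P r p s | c. (\<forall>p\<in>C. 0 \<le> c p) \<and> (\<Sum>p\<in>C. c p) = 1}"

definition geometric_realization :: "'a set \<Rightarrow> ('a \<times> 'a) set \<Rightarrow> ('a \<Rightarrow> real) set" where
  "geometric_realization P r =
     (\<Union>C \<in> {C. C \<in> Chains r \<and> C \<subseteq> P \<and> finite C \<and> C \<noteq> {}}. simplex_of P r C)"

definition realization_metric :: "'a set \<Rightarrow> ('a \<times> 'a) set \<Rightarrow> ('a \<Rightarrow> real) metric" where
  "realization_metric P r = submetric (cube_metric P) (geometric_realization P r)"

definition uniformly_homotopic ::
    "real \<Rightarrow> 'x metric \<Rightarrow> 'y metric \<Rightarrow> ('x \<Rightarrow> 'y) \<Rightarrow> ('x \<Rightarrow> 'y) \<Rightarrow> bool" where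
  "uniformly_homotopic \<epsilon> X Y f g \<longleftrightarrow>
     (\<exists>H. uniformly_continuous_map (prod_metric X (submetric euclidean_metric {0..1::real})) Y H \<and>
          (\<forall>x \<in> mspace X. H (x, 0) = f x \<and> H (x, 1) = g x) \<and>
          (\<forall>x \<in> mspace X. \<forall>t \<in> {0..1}. mdist Y (H (x, t)) (H (x, 0)) \<le> \<epsilon>))"

text \<open>
  Uniform local contractibility of \<open>Y\<close> asks that for each \<open>\<epsilon>\<close> one \<open>\<delta>\<close> satisfies
  \<open>close_maps_homotopic \<epsilon> \<delta> X Y\<close> for all metric spaces \<open>X\<close>.  Since \<open>\<forall>X :: 'x metric\<close> only reaches the
  spaces carried by subsets of \<open>'x\<close>, a \<open>\<delta>\<close> found for \<open>'x\<close> might depend on \<open>'x\<close>.  A statement that a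
  \<open>\<delta>\<close> is independent of \<open>'x\<close> has to transfer a \<open>\<delta>\<close> from one fixed type to arbitrary \<open>'x\<close>; the pairs
  of points of \<open>Y\<close> are a suitable fixed type.
\<close>

definition close_maps_homotopic :: "real \<Rightarrow> real \<Rightarrow> 'x metric \<Rightarrow> 'y metric \<Rightarrow> bool" where
  "close_maps_homotopic \<epsilon> \<delta> X Y \<longleftrightarrow>
     (\<forall>f g. uniformly_continuous_map X Y f \<longrightarrow> uniformly_continuous_map X Y g \<longrightarrow>
        (\<forall>x \<in> mspace X. mdist Y (f x) (g x) < \<delta>) \<longrightarrow> uniformly_homotopic \<epsilon> X Y f g)"

text \<open>
  \<open>metric\<close> and \<open>submetric\<close> are only meaningful on genuine metric spaces; the following facts
  show that they are applied to such, and that the realization is not cut down by the cube.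
\<close>

lemma bdd_above_sup_dist:
  assumes "f \<in> cube P" "g \<in> cube P"
  shows "bdd_above (insert 0 ((\<lambda>s. \<bar>f s - g s\<bar>) ` P))"
proof (rule bdd_aboveI)
  fix y assume y: "y \<in> insert 0 ((\<lambda>s. \<bar>f s - g s\<bar>) ` P)"
  have "\<bar>f s - g s\<bar> \<le> 1" if "s \<in> P" for s
  proof -
    have "f s \<in> {0..1}" "g s \<in> {0..1}"
      using assms that unfolding cube_def by (auto dest: PiE_mem)
    then show ?thesis by auto
  qed
  then show "y \<le> 1" using y by auto
qed

lemma Metric_space_cube: "Metric_space (cube P) (sup_dist P)"
proof
  fix f g :: "'a \<Rightarrow> real"
  show "0 \<le> sup_dist P f g"
    using bdd_above_sup_dist[of f P g] by (auto simp: sup_dist_def intro!: cSup_upper)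
  show "sup_dist P f g = sup_dist P g f"
    by (simp add: sup_dist_def abs_minus_commute)
next
  fix f g :: "'a \<Rightarrow> real"
  assume fg: "f \<in> cube P" "g \<in> cube P"
  show "sup_dist P f g = 0 \<longleftrightarrow> f = g"
  proof
    assume 0: "sup_dist P f g = 0"
    have "f s = g s" if "s \<in> P" for s
      using cSup_upper[OF _ bdd_above_sup_dist[OF fg], of "\<bar>f s - g s\<bar>"] 0 fg that
      by (auto simp: sup_dist_def)
    then show "f = g"
      using fg unfolding cube_def by (blast intro: PiE_ext)
  next
    assume "f = g"
    moreover have "insert 0 ((\<lambda>s. 0) ` P) = {0::real}"
      by auto
    ultimately show "sup_dist P f g = 0"
      by (simp only: sup_dist_def diff_self abs_zero cSup_singleton if_cancel)
  qed
next
  fix f g h :: "'a \<Rightarrow> real"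
  assume fgh: "f \<in> cube P" "g \<in> cube P" "h \<in> cube P"
  have up: "\<bar>u s - v s\<bar> \<le> sup_dist P u v" "0 \<le> sup_dist P u v"
    if "u \<in> cube P" "v \<in> cube P" "s \<in> P" for u v s
    using cSup_upper[OF _ bdd_above_sup_dist[OF that(1,2)]] that by (auto simp: sup_dist_def)
  have nn: "0 \<le> sup_dist P u v" if "u \<in> cube P" "v \<in> cube P" for u v
    using cSup_upper[OF _ bdd_above_sup_dist[OF that]] that by (auto simp: sup_dist_def)
  have "\<bar>f s - h s\<bar> \<le> sup_dist P f g + sup_dist P g h" if "s \<in> P" for s
    using up(1)[OF fgh(1,2) that] up(1)[OF fgh(2,3) that] by linarith
  then have "Sup (insert 0 ((\<lambda>s. \<bar>f s - h s\<bar>) ` P)) \<le> sup_dist P f g + sup_dist P g h"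
    using nn[OF fgh(1,2)] nn[OF fgh(2,3)] by (intro cSup_least) auto
  then show "sup_dist P f h \<le> sup_dist P f g + sup_dist P g h"
    using fgh by (simp add: sup_dist_def)
qed

lemma mspace_cube_metric [simp]: "mspace (cube_metric P) = cube P"
  and mdist_cube_metric [simp]: "mdist (cube_metric P) = sup_dist P"
  by (simp_all add: cube_metric_def Metric_space.mspace_metric Metric_space.mdist_metric
      Metric_space_cube)

lemma geometric_realization_subset_cube: "geometric_realization P r \<subseteq> cube P"
proof
  fix f assume "f \<in> geometric_realization P r"
  then obtain C c where C: "finite C" and c: "\<forall>p\<in>C. 0 \<le> c p" "(\<Sum>p\<in>C. c p) = 1"
    and f: "f = (\<lambda>s\<in>P. \<Sum>p\<in>C. c p * vertex P r p s)"
    unfolding geometric_realization_def simplex_of_def by blast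
  have v: "0 \<le> vertex P r p s \<and> vertex P r p s \<le> 1" if "s \<in> P" for p s
    using that by (simp add: vertex_def indicator_def)
  have "(\<Sum>p\<in>C. c p * vertex P r p s) \<le> (\<Sum>p\<in>C. c p)" if "s \<in> P" for s
    using v[OF that] c by (intro sum_mono) (simp add: mult_left_le)
  moreover have "0 \<le> (\<Sum>p\<in>C. c p * vertex P r p s)" if "s \<in> P" for s
    using v[OF that] c by (intro sum_nonneg) simp
  ultimately show "f \<in> cube P"
    using c(2) unfolding f cube_def by auto
qed

lemma mspace_realization_metric [simp]:
  "mspace (realization_metric P r) = geometric_realization P r"
  using geometric_realization_subset_cube by (auto simp: realization_metric_def)

lemma mdist_realization_metric [simp]: "mdist (realization_metric P r) = sup_dist P"
  by (simp add: realization_metric_def)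

end

theory Submission
  imports Defs
begin

text \<open>
  A function in the cube lies in the realization exactly when it has finitely many values and each of
  its superlevel sets at levels in \<open>(0, 1]\<close> is a principal ideal.  Hence \<open>\<Phi> (f s) (g s)\<close> stays in the
  realization for close \<open>f\<close> and \<open>g\<close> as soon as every superlevel set of \<open>\<Phi>\<close> is, on a thin band around
  the diagonal, of the form \<open>x \<ge> a\<close> or \<open>y \<ge> a\<close>.  Two fine staircase functions of the interval, rising
  on separated intervals, give the homotopy: deform \<open>f\<close> linearly to its first staircase, this one
  linearly to the second staircase of \<open>g\<close>, and the latter linearly to \<open>g\<close>.  The same formula in
  \<open>f s\<close>, \<open>g s\<close> and \<open>t\<close> is used for every \<open>s\<close>, so uniform continuity is that of one continuous
  function on the compact cube \<open>[0, 1]\<^sup>3\<close>.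
\<close>

section \<open>The realization as a space of functions with principal superlevel sets\<close>

lemma finite_chain_has_least:
  assumes "finite B" "B \<noteq> {}" "refl_on P r" "trans r" "B \<subseteq> P" "B \<in> Chains r"
  shows "\<exists>m\<in>B. \<forall>b\<in>B. (m, b) \<in> r"
  using assms
proof (induction rule: finite_ne_induct)
  case (singleton x)
  then show ?case by (auto simp: refl_on_def)
next
  case (insert x F)
  then obtain m where m: "m \<in> F" "\<forall>b\<in>F. (m, b) \<in> r"
    by (auto simp: Chains_def)
  have "(x, m) \<in> r \<or> (m, x) \<in> r"
    using insert.prems m by (auto simp: Chains_def)
  then show ?case
  proof
    assume xm: "(x, m) \<in> r"
    have "(x, b) \<in> r" if "b \<in> F" for b
      using transD[OF \<open>trans r\<close> xm] m that by blast
    moreover have "(x, x) \<in> r"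
      using insert.prems by (auto simp: refl_on_def)
    ultimately show ?thesis by blast
  qed (use m in blast)
qed

lemma finite_chain_has_greatest:
  assumes "finite B" "B \<noteq> {}" "refl_on P r" "trans r" "B \<subseteq> P" "B \<in> Chains r"
  shows "\<exists>m\<in>B. \<forall>b\<in>B. (b, m) \<in> r"
proof -
  have "refl_on P (r\<inverse>)" "B \<in> Chains (r\<inverse>)"
    using assms by (auto simp: refl_on_def Chains_def)
  then show ?thesis
    using finite_chain_has_least[of B P "r\<inverse>"] assms by auto
qed

text \<open>A telescoping sum: each \<open>v\<close> contributes its distance to its predecessor in
  \<open>insert 0 V\<close>. The induction adds elements in increasing order, so that a new maximum
  leaves all earlier gaps unchanged.\<close>

lemma sum_gaps_below:
  fixes V :: "real set"
  assumes "finite V" "\<forall>v\<in>V. 0 < v" "x \<in> insert 0 V"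
  shows "(\<Sum>v\<in>{v\<in>V. v \<le> x}. v - Max (insert 0 {w\<in>V. w < v})) = x"
  using assms
proof (induction V arbitrary: x rule: finite_linorder_max_induct)
  case (insert b A)
  have below: "{w \<in> insert b A. w < v} = {w \<in> A. w < v}" if "v \<in> A" for v
    using insert.hyps that by force
  have gap: "(\<Sum>v\<in>{v\<in>A. v \<le> y}. v - Max (insert 0 {w\<in>insert b A. w < v})) = y"
    if "y \<in> insert 0 A" for y
  proof -
    have "(\<Sum>v\<in>{v\<in>A. v \<le> y}. v - Max (insert 0 {w\<in>insert b A. w < v}))
        = (\<Sum>v\<in>{v\<in>A. v \<le> y}. v - Max (insert 0 {w\<in>A. w < v}))"
      by (rule sum.cong[OF refl]) (subst below, auto)
    also have "\<dots> = y"
      using insert.IH insert.prems that by auto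
    finally show ?thesis .
  qed
  have "b \<notin> A" "0 < b"
    using insert by auto
  show ?case
  proof (cases "x = b")
    case True
    define y where "y = Max (insert 0 A)"
    have y: "y \<in> insert 0 A" "\<forall>a\<in>A. a \<le> y"
      using insert.hyps Max_in[of "insert 0 A"] unfolding y_def by auto
    have "{v\<in>insert b A. v \<le> x} = insert b {v\<in>A. v \<le> y}"
      using insert.hyps y True by force
    moreover have "{w \<in> insert b A. w < b} = A"
      using insert.hyps by auto
    ultimately show ?thesis
      using gap[OF y(1)] \<open>b \<notin> A\<close> insert.hyps True by (simp add: y_def)
  next
    case False
    then have "x \<in> insert 0 A" "{v\<in>insert b A. v \<le> x} = {v\<in>A. v \<le> x}"
      using insert \<open>0 < b\<close> by force+
    then show ?thesis using gap by simp
  qed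
qed simp

text \<open>At \<open>s\<close> the function is the total weight of the members of the chain
  \<open>C\<close> above \<open>s\<close>. So it has finitely many values and is antitone, and its
  superlevel set at \<open>c\<close> is the ideal below the greatest \<open>q\<close> in
  \<open>C\<close> with \<open>c \<le> f q\<close>.\<close>

lemma geometric_realization_superlevel:
  assumes "partial_order_on P r" "f \<in> geometric_realization P r"
  shows "finite (f ` P)"
    and "c \<in> {0<..1} \<Longrightarrow> \<exists>p\<in>P. \<forall>s\<in>P. c \<le> f s \<longleftrightarrow> (s, p) \<in> r"
proof -
  note po = partial_order_onD[OF assms(1)]
  obtain C u where C: "C \<in> Chains r" "C \<subseteq> P" "finite C" "C \<noteq> {}"
    and u: "\<forall>p\<in>C. 0 \<le> u p" "(\<Sum>p\<in>C. u p) = 1"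
    and f: "f = (\<lambda>s\<in>P. \<Sum>p\<in>C. u p * vertex P r p s)"
    using assms(2) unfolding geometric_realization_def simplex_of_def by blast
  have fs: "f s = sum u {p\<in>C. (s, p) \<in> r}" if "s \<in> P" for s
  proof -
    have "f s = (\<Sum>p\<in>C. if (s, p) \<in> r then u p else 0)"
      unfolding f using that by (auto simp: vertex_def indicator_def intro!: sum.cong)
    then show ?thesis using C(3) by (simp add: sum.inter_filter)
  qed
  have "f ` P \<subseteq> sum u ` Pow C"
  proof (intro image_subsetI)
    fix s assume "s \<in> P"
    then show "f s \<in> sum u ` Pow C" unfolding fs[OF \<open>s \<in> P\<close>] by (intro imageI) auto
  qed
  then show "finite (f ` P)"
    by (rule finite_subset) (simp add: C(3))
  assume c: "c \<in> {0<..1}"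
  have anti: "f p \<le> f s" if "(s, p) \<in> r" for s p
  proof -
    have "s \<in> P" "p \<in> P" using that po(4) by auto
    moreover have "sum u {q\<in>C. (p, q) \<in> r} \<le> sum u {q\<in>C. (s, q) \<in> r}"
      using transD[OF po(2) that] C(3) u(1) by (intro sum_mono2) auto
    ultimately show ?thesis
      by (simp only: fs)
  qed
  have subchain: "D \<in> Chains r" "D \<subseteq> P" "finite D" if "D \<subseteq> C" for D
    using that C finite_subset[of D C] by (simp_all add: Chains_def subset_iff)
  \<comment> \<open>The least member of \<open>C\<close> collects the whole weight, so
    \<open>f l = 1\<close> and some member of \<open>C\<close> reaches the level
    \<open>c\<close>.\<close>
  obtain l where l: "l \<in> C" "\<forall>b\<in>C. (l, b) \<in> r"
    using finite_chain_has_least[OF C(3,4) po(1,2) C(2,1)] by blast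
  have "{q\<in>C. (l, q) \<in> r} = C" using l by auto
  then have "f l = 1" using fs[of l] l(1) C(2) u(2) by (simp add: subset_iff)
  define D where "D = {p\<in>C. c \<le> f p}"
  have "D \<subseteq> C" "D \<noteq> {}" using l \<open>f l = 1\<close> c by (auto simp: D_def)
  then obtain q where q: "q \<in> D" "\<forall>b\<in>D. (b, q) \<in> r"
    using finite_chain_has_greatest[OF subchain(3) _ po(1,2) subchain(2,1)] by metis
  show "\<exists>p\<in>P. \<forall>s\<in>P. c \<le> f s \<longleftrightarrow> (s, p) \<in> r"
  proof (intro bexI ballI iffI)
    fix s assume "s \<in> P" "(s, q) \<in> r"
    then show "c \<le> f s" using anti[of s q] q by (auto simp: D_def)
  next
    fix s assume s: "s \<in> P" "c \<le> f s"
    \<comment> \<open>Let \<open>m\<close> be the least member of \<open>C\<close> above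
      \<open>s\<close>; there is one because \<open>f s\<close> is positive. The same members of
      \<open>C\<close> lie above \<open>m\<close> as above \<open>s\<close>, so
      \<open>f m = f s\<close>. Hence \<open>m\<close> is in \<open>D\<close>, and \<open>s\<close>
      is below \<open>m\<close>, which is below \<open>q\<close>.\<close>
    let ?E = "{p\<in>C. (s, p) \<in> r}"
    have "?E \<noteq> {}"
    proof
      assume "?E = {}"
      then show False using fs[OF s(1)] s c by (simp only: sum.empty) simp
    qed
    then obtain m where m: "m \<in> ?E" "\<forall>b\<in>?E. (m, b) \<in> r"
      using finite_chain_has_least[OF subchain(3) _ po(1,2) subchain(2,1), of ?E]
      by (metis (no_types, lifting) mem_Collect_eq subsetI)
    have "?E = {p\<in>C. (m, p) \<in> r}"
    proof (intro Collect_cong conj_cong refl iffI)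
      fix p assume "p \<in> C" "(s, p) \<in> r"
      then show "(m, p) \<in> r" using m by simp
    next
      fix p assume "(m, p) \<in> r"
      then show "(s, p) \<in> r" using m transD[OF po(2), of s m p] by simp
    qed
    moreover have "m \<in> P" using m C(2) by blast
    ultimately have "f m = f s" using fs[of s] fs[of m] s by simp
    then have "m \<in> D" using s m by (simp add: D_def)
    then show "(s, q) \<in> r"
      using q m transD[OF po(2), of s m q] by simp
  qed (use q C in \<open>auto simp: D_def\<close>)
qed

text \<open>The chain consists of the generators \<open>p v\<close> of the superlevel sets at the
  positive values \<open>v\<close> of \<open>f\<close>, and \<open>p v\<close> is weighted by the
  gap between \<open>v\<close> and the next smaller value or 0. At \<open>s\<close> the gaps up to
  \<open>f s\<close> telescope to \<open>f s\<close>.\<close>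

lemma geometric_realizationI:
  assumes "partial_order_on P r" "f \<in> cube P" "finite (f ` P)"
    and sup: "\<And>c. c \<in> {0<..1} \<Longrightarrow> \<exists>p\<in>P. \<forall>s\<in>P. c \<le> f s \<longleftrightarrow> (s, p) \<in> r"
  shows "f \<in> geometric_realization P r"
proof -
  note po = partial_order_onD[OF assms(1)]
  have f01: "0 \<le> f s" "f s \<le> 1" if "s \<in> P" for s
    using assms(2) that by (auto simp: cube_def dest: PiE_mem)
  define V where "V = {v \<in> f ` P. 0 < v}"
  have V: "finite V" "\<forall>v\<in>V. 0 < v" "V \<subseteq> {0<..1}"
    using assms(3) f01 by (auto simp: V_def)
  obtain p where p: "\<And>v. v \<in> V \<Longrightarrow> p v \<in> P"
    "\<And>v s. \<lbrakk>v \<in> V; s \<in> P\<rbrakk> \<Longrightarrow> v \<le> f s \<longleftrightarrow> (s, p v) \<in> r"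
  proof -
    have "\<forall>v\<in>V. \<exists>p. p \<in> P \<and> (\<forall>s\<in>P. v \<le> f s \<longleftrightarrow> (s, p) \<in> r)"
      using sup V(3) by (meson subsetD)
    then show ?thesis using that by metis
  qed
  have pp: "v \<le> f (p v)" if "v \<in> V" for v
    using p(2)[OF that p(1)[OF that]] refl_onD[OF po(1) p(1)[OF that]] by simp
  have le: "(p w, p v) \<in> r" if "v \<in> V" "w \<in> V" "v \<le> w" for v w
  proof -
    have "v \<le> f (p w)" using pp[of w] that by linarith
    then show ?thesis using p(2)[OF that(1) p(1)[OF that(2)]] by simp
  qed
  \<comment> \<open>If \<open>w = f (p v)\<close> exceeded \<open>v\<close>, the ideal of level
    \<open>w\<close> would contain \<open>p v\<close> and hence every point below it, among them a
    point of value exactly \<open>v\<close>. It follows that \<open>p\<close> is injective and that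
    the weight of a vertex \<open>q\<close> can be written \<open>gap (f q)\<close>.\<close>
  have fp: "f (p v) = v" if v: "v \<in> V" for v
  proof (rule antisym)
    show "v \<le> f (p v)" using pp v by blast
    moreover have "0 < v" using V(2) v by blast
    ultimately have w: "f (p v) \<in> V" using p(1)[OF v] by (simp add: V_def)
    obtain s where s: "s \<in> P" "f s = v" using v by (auto simp: V_def)
    have "(s, p v) \<in> r" using p(2)[OF v s(1)] s(2) by simp
    moreover have "(p v, p (f (p v))) \<in> r" using p(2)[OF w p(1)[OF v]] by simp
    ultimately have "(s, p (f (p v))) \<in> r" by (rule transD[OF po(2)])
    then show "f (p v) \<le> v" using p(2)[OF w s(1)] s(2) by simp
  qed
  then have inj: "inj_on p V" by (metis inj_on_def)
  define gap where "gap v = v - Max (insert 0 {w\<in>V. w < v})" for v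
  have gap0: "0 \<le> gap v" if "v \<in> V" for v
  proof -
    have "Max (insert 0 {w\<in>V. w < v}) \<le> v"
      using V that by (intro Max.boundedI) auto
    then show ?thesis by (simp add: gap_def)
  qed
  \<comment> \<open>The value 1 is attained, at the generator of the superlevel set of level 1. This
    makes the weights sum to 1 and the chain nonempty.\<close>
  have "1 \<in> {0<..1::real}" by simp
  from sup[OF this] obtain m where m: "m \<in> P" "\<forall>s\<in>P. 1 \<le> f s \<longleftrightarrow> (s, m) \<in> r"
    by blast
  then have "f m = 1" using refl_onD[OF po(1) m(1)] f01[OF m(1)] by (simp add: antisym)
  then have one: "1 \<in> V" using m(1) by (force simp: V_def)
  have "{v \<in> V. v \<le> 1} = V" using V by auto
  then have total: "(\<Sum>q\<in>p ` V. gap (f q)) = 1"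
    using sum_gaps_below[OF V(1,2), of 1] one inj fp by (simp add: sum.reindex gap_def)
  have "f s = (\<Sum>q\<in>p ` V. gap (f q) * vertex P r q s)" if s: "s \<in> P" for s
  proof -
    have "(\<Sum>q\<in>p ` V. gap (f q) * vertex P r q s) = (\<Sum>v\<in>V. if v \<le> f s then gap v else 0)"
      using inj fp s p(2) by (auto simp: sum.reindex vertex_def indicator_def intro!: sum.cong)
    also have "\<dots> = (\<Sum>v\<in>{v\<in>V. v \<le> f s}. gap v)"
      using V by (simp add: sum.inter_filter)
    also have "\<dots> = f s"
      unfolding gap_def using f01[OF s] s by (intro sum_gaps_below V) (auto simp: V_def)
    finally show ?thesis ..
  qed
  then have "f = (\<lambda>s\<in>P. \<Sum>q\<in>p ` V. gap (f q) * vertex P r q s)"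
    using assms(2) by (auto simp: cube_def fun_eq_iff PiE_iff extensional_def)
  then have "f \<in> simplex_of P r (p ` V)"
    unfolding simplex_of_def using total gap0 fp
    by (intro CollectI exI[of _ "\<lambda>q. gap (f q)"]) auto
  moreover have "(p v, p w) \<in> r \<or> (p w, p v) \<in> r" if "v \<in> V" "w \<in> V" for v w
    using le[OF that] le[OF that(2,1)] linear[of v w] by blast
  then have "p ` V \<in> Chains r"
    unfolding Chains_def by blast
  ultimately show ?thesis
    unfolding geometric_realization_def using V(1) one p(1) by blast
qed

text \<open>Each superlevel set of the combined function is one of \<open>f\<close> or one of
  \<open>g\<close>, hence a principal ideal. Which of the two it is may vary with the level
  \<open>c\<close>, but not with the point \<open>s\<close>.\<close>

lemma geometric_realization_combine:
  assumes po: "partial_order_on P r"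
    and f: "f \<in> geometric_realization P r" and g: "g \<in> geometric_realization P r"
    and near: "\<forall>s\<in>P. \<bar>f s - g s\<bar> \<le> \<delta>"
    and range: "\<And>x y. \<lbrakk>x \<in> {0..1}; y \<in> {0..1}\<rbrakk> \<Longrightarrow> \<Phi> x y \<in> {0..1}"
    and level: "\<And>c. c \<in> {0<..1} \<Longrightarrow> \<exists>a\<in>{0<..1}.
        (\<forall>x\<in>{0..1}. \<forall>y\<in>{0..1}. \<bar>x - y\<bar> \<le> \<delta> \<longrightarrow> (c \<le> \<Phi> x y \<longleftrightarrow> a \<le> x)) \<or>
        (\<forall>x\<in>{0..1}. \<forall>y\<in>{0..1}. \<bar>x - y\<bar> \<le> \<delta> \<longrightarrow> (c \<le> \<Phi> x y \<longleftrightarrow> a \<le> y))"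
  shows "(\<lambda>s\<in>P. \<Phi> (f s) (g s)) \<in> geometric_realization P r"
proof (rule geometric_realizationI[OF po])
  have "f \<in> P \<rightarrow>\<^sub>E {0..1}" "g \<in> P \<rightarrow>\<^sub>E {0..1}"
    using f g geometric_realization_subset_cube[of P r] unfolding cube_def by blast+
  then have fg: "f s \<in> {0..1}" "g s \<in> {0..1}" if "s \<in> P" for s
    using that by (meson PiE_mem)+
  then show "(\<lambda>s\<in>P. \<Phi> (f s) (g s)) \<in> cube P"
    unfolding cube_def using range by (simp add: PiE_iff)
  have "(\<lambda>s\<in>P. \<Phi> (f s) (g s)) ` P \<subseteq> case_prod \<Phi> ` (f ` P \<times> g ` P)"
    by auto
  then show "finite ((\<lambda>s\<in>P. \<Phi> (f s) (g s)) ` P)"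
    by (rule finite_subset) (simp add: geometric_realization_superlevel[OF po] f g)
  fix c :: real assume "c \<in> {0<..1}"
  then obtain a where a: "a \<in> {0<..1}"
    "(\<forall>s\<in>P. c \<le> \<Phi> (f s) (g s) \<longleftrightarrow> a \<le> f s) \<or> (\<forall>s\<in>P. c \<le> \<Phi> (f s) (g s) \<longleftrightarrow> a \<le> g s)"
    using level[of c] by (metis fg near)
  show "\<exists>p\<in>P. \<forall>s\<in>P. c \<le> (\<lambda>s\<in>P. \<Phi> (f s) (g s)) s \<longleftrightarrow> (s, p) \<in> r"
    using a(2) geometric_realization_superlevel(2)[OF po f a(1)]
      geometric_realization_superlevel(2)[OF po g a(1)] by auto
qed

section \<open>Staircase functions\<close>

definition clamp01 :: "real \<Rightarrow> real" where
  "clamp01 u = max 0 (min 1 u)"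

text \<open>A sum of \<open>N\<close> unit ramps of slope 4; the \<open>k\<close>-th rises on
  \<open>[k + a/4, k + (a+1)/4]\<close>. The parameter \<open>a\<close> shifts the rise within the
  unit step.\<close>

definition stairs :: "nat \<Rightarrow> real \<Rightarrow> real \<Rightarrow> real" where
  "stairs N a z = (\<Sum>k<N. clamp01 (4 * (z - real k) - a))"

lemma clamp01_simps [simp]:
  "u \<le> 0 \<Longrightarrow> clamp01 u = 0" "1 \<le> u \<Longrightarrow> clamp01 u = 1" "0 \<le> u \<Longrightarrow> u \<le> 1 \<Longrightarrow> clamp01 u = u"
  by (auto simp: clamp01_def)

lemma clamp01_bounds [simp]: "0 \<le> clamp01 u" "clamp01 u \<le> 1"
  by (auto simp: clamp01_def)

lemma clamp01_mono: "u \<le> v \<Longrightarrow> clamp01 u \<le> clamp01 v"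
  by (auto simp: clamp01_def)

lemma continuous_on_clamp01 [continuous_intros]:
  "continuous_on S f \<Longrightarrow> continuous_on S (\<lambda>x. clamp01 (f x))"
  unfolding clamp01_def by (intro continuous_intros)

lemma stairs_mono: "x \<le> y \<Longrightarrow> stairs N a x \<le> stairs N a y"
  unfolding stairs_def by (intro sum_mono clamp01_mono) simp

lemma continuous_on_stairs [continuous_intros]:
  "continuous_on S f \<Longrightarrow> continuous_on S (\<lambda>x. stairs N a (f x))"
  unfolding stairs_def by (intro continuous_intros)

text \<open>For \<open>a\<close> between 0 and 3 each ramp rises inside its own unit interval. At
  \<open>k + v\<close> the ramps before the \<open>k\<close>-th are therefore complete and those
  after it have not begun.\<close>

lemma stairs_add:
  assumes "k < N" "0 \<le> v" "v \<le> 1" "0 \<le> a" "a \<le> 3"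
  shows "stairs N a (real k + v) = real k + clamp01 (4 * v - a)"
proof -
  have "stairs N a (real k + v) = (\<Sum>j<N. of_bool (j < k) + (if j = k then clamp01 (4 * v - a) else 0))"
    unfolding stairs_def
  proof (intro sum.cong refl)
    fix j
    consider "j < k" | "j = k" | "k < j" by linarith
    then show "clamp01 (4 * (real k + v - real j) - a)
        = of_bool (j < k) + (if j = k then clamp01 (4 * v - a) else 0)"
    proof cases
      case 1
      then have "real j + 1 \<le> real k" by linarith
      then show ?thesis using assms 1 by simp
    next
      case 3
      then have "real k + 1 \<le> real j" by linarith
      then show ?thesis using assms 3 by simp
    qed simp
  qed
  also have "\<dots> = real (card {j. j < N \<and> j < k}) + clamp01 (4 * v - a)"
    using assms(1) by (simp add: sum.distrib sum.If_cases of_bool_def Int_def)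
  also have "{j. j < N \<and> j < k} = {..<k}" using assms(1) by auto
  finally show ?thesis by simp
qed

lemma stairs_near:
  assumes "0 \<le> z" "z \<le> real N" "0 \<le> a" "a \<le> 3"
  shows "\<bar>stairs N a z - z\<bar> \<le> 1"
proof (cases "N = 0")
  case True
  then show ?thesis using assms by (simp add: stairs_def)
next
  case False
  obtain k v where kv: "k < N" "z = real k + v" "0 \<le> v" "v \<le> 1"
  proof (cases "z = real N")
    \<comment> \<open>The right endpoint lies in no half-open unit step with index below
      \<open>N\<close>, so it is taken as the end of the last step.\<close>
    case True
    then show ?thesis using that[of "N - 1" 1] \<open>N \<noteq> 0\<close> by (simp add: of_nat_diff)
  next
    case False
    have "real (nat \<lfloor>z\<rfloor>) \<le> z" "z < real (nat \<lfloor>z\<rfloor>) + 1"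
      using assms by (auto simp: of_nat_nat)
    then show ?thesis
      using that[of "nat \<lfloor>z\<rfloor>" "z - real (nat \<lfloor>z\<rfloor>)"] False assms by linarith
  qed
  show ?thesis
    using stairs_add[OF kv(1,3,4) assms(3,4)] clamp01_bounds[of "4 * v - a"] kv(3,4)
    unfolding kv(2) by linarith
qed

lemma stairs_0: "0 \<le> a \<Longrightarrow> stairs N a 0 = 0"
  unfolding stairs_def by (intro sum.neutral) simp

lemma stairs_top: "a \<le> 3 \<Longrightarrow> stairs N a (real N) = real N"
proof -
  assume "a \<le> 3"
  have "clamp01 (4 * (real N - real k) - a) = 1" if "k < N" for k
  proof -
    have "real k + 1 \<le> real N" using that by linarith
    then show ?thesis using \<open>a \<le> 3\<close> by simp
  qed
  then show ?thesis by (simp add: stairs_def)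
qed

text \<open>The \<open>k\<close>-th ramp reaches relative height \<open>w\<close> exactly at
  \<open>k + (a + w) / 4\<close>; together with \<open>stairs_above\<close> this locates the
  threshold of the level \<open>k + w\<close>.\<close>

lemma stairs_below:
  assumes "k < N" "z < real k + (a + w) / 4" "0 < w" "w \<le> 1" "0 \<le> a" "a \<le> 3"
  shows "stairs N a z < real k + w"
proof -
  \<comment> \<open>A point \<open>z\<close> below \<open>k\<close> is first moved up to
    \<open>k\<close>, so that the formula for step \<open>k\<close> applies.\<close>
  have "stairs N a z \<le> stairs N a (real k + max 0 (z - real k))"
    by (intro stairs_mono) simp
  also have "\<dots> = real k + clamp01 (4 * max 0 (z - real k) - a)"
    using assms by (intro stairs_add) (auto simp: field_simps)
  also have "\<dots> < real k + w"
  proof -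
    have "4 * max 0 (z - real k) - a < w"
      using assms by (auto simp: max_def field_simps)
    then show ?thesis
      using assms by (auto simp: clamp01_def)
  qed
  finally show ?thesis .
qed

lemma stairs_above:
  assumes "k < N" "real k + (a + w) / 4 \<le> z" "0 \<le> w" "w \<le> 1" "0 \<le> a" "a \<le> 3"
  shows "real k + w \<le> stairs N a z"
proof -
  have "real k + w = stairs N a (real k + (a + w) / 4)"
    using assms by (subst stairs_add) (auto simp: field_simps)
  also have "\<dots> \<le> stairs N a z"
    using assms by (intro stairs_mono)
  finally show ?thesis .
qed

text \<open>
  The first staircase rises on \<open>[k, k + 1/4]\<close>, the second on \<open>[k + 1/2, k + 3/4]\<close>.  Along the band
  \<open>\<bar>x - y\<bar> \<le> 1/4\<close> one of them is always constant, so a convex combination locally depends on only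
  one of the two variables.
\<close>

lemma stairs_combination_level:
  assumes c: "0 < c" "c \<le> real N" and t: "0 \<le> t" "t \<le> 1"
  shows "\<exists>a>0. a \<le> real N \<and>
    ((\<forall>x y. \<bar>x - y\<bar> \<le> 1/4 \<longrightarrow> (c \<le> (1-t) * stairs N 0 x + t * stairs N 2 y \<longleftrightarrow> a \<le> x)) \<or>
     (\<forall>x y. \<bar>x - y\<bar> \<le> 1/4 \<longrightarrow> (c \<le> (1-t) * stairs N 0 x + t * stairs N 2 y \<longleftrightarrow> a \<le> y)))"
proof -
  \<comment> \<open>With the ceiling, \<open>c\<close> lies in \<open>(k, k + 1]\<close>: an integer
    level is the top of a step.\<close>
  define k where "k = nat (\<lceil>c\<rceil> - 1)"
  have k: "real k < c" "c \<le> real k + 1" "k < N"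
    using c unfolding k_def by linarith+
  then have N: "real k + 1 \<le> real N" by linarith
  show ?thesis
  \<comment> \<open>Along the band the combination climbs from \<open>k\<close> to
    \<open>k + 1\<close> in two stages: by \<open>1 - t\<close> while the first staircase rises,
    then by \<open>t\<close> while the second does. The cases say in which stage \<open>c\<close> is
    reached, and \<open>w\<close> is the relative height of the rising staircase there.\<close>
  proof (cases "c - k \<le> 1 - t")
    case True
    define w where "w = (c - k) / (1 - t)"
    have t1: "0 < 1 - t" using True k by linarith
    have w: "0 < w" "w \<le> 1" "(1 - t) * w = c - k"
      using True k(1) t1 by (simp_all add: w_def)
    have combine: "(1-t) * (real k + w) + t * real k = c"
    proof -
      have "(1-t) * (real k + w) + t * real k = real k + (1 - t) * w"
        by (simp add: algebra_simps)
      then show ?thesis using w(3) by linarith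
    qed
    have "c \<le> (1-t) * stairs N 0 x + t * stairs N 2 y \<longleftrightarrow> real k + w / 4 \<le> x"
      if xy: "\<bar>x - y\<bar> \<le> 1/4" for x y
    proof
      assume x: "real k + w / 4 \<le> x"
      have "real k + w \<le> stairs N 0 x"
        using stairs_above[of k N 0 w x] k w x by simp
      \<comment> \<open>Since \<open>y\<close> is at least \<open>k - 1/4\<close>, the second
        staircase has finished its ramp \<open>k - 1\<close>.\<close>
      moreover have "real k \<le> stairs N 2 y"
      proof (cases k)
        case 0
        then show ?thesis by (simp add: stairs_def sum_nonneg)
      next
        case (Suc j)
        then have "real j + 3 / 4 \<le> y"
          using x xy w by linarith
        then show ?thesis
          using stairs_above[of j N 2 1 y] k Suc by simp
      qed
      ultimately have "(1-t) * (real k + w) + t * real k \<le> (1-t) * stairs N 0 x + t * stairs N 2 y"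
        using t by (intro add_mono mult_left_mono) auto
      then show "c \<le> (1-t) * stairs N 0 x + t * stairs N 2 y"
        unfolding combine .
    next
      assume le: "c \<le> (1-t) * stairs N 0 x + t * stairs N 2 y"
      show "real k + w / 4 \<le> x"
      proof (rule ccontr)
        assume x: "\<not> real k + w / 4 \<le> x"
        have "stairs N 0 x < real k + w"
          using stairs_below[of k N x 0 w] k w x by simp
        \<comment> \<open>Here \<open>y < k + 1/2\<close>, where ramp \<open>k\<close> of the second
          staircase starts.\<close>
        moreover have "stairs N 2 y \<le> stairs N 2 (real k + 1/2)"
          using x xy w by (intro stairs_mono) linarith
        moreover have "stairs N 2 (real k + 1/2) = real k"
          using stairs_add[of k N "1/2" 2] k by simp
        ultimately have "(1-t) * stairs N 0 x + t * stairs N 2 y < (1-t) * (real k + w) + t * real k"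
          using t t1 by (intro add_less_le_mono mult_strict_left_mono mult_left_mono) auto
        then show False
          using le unfolding combine by linarith
      qed
    qed
    moreover have "0 < real k + w / 4" "real k + w / 4 \<le> real N"
      using w(1,2) N by linarith+
    ultimately show ?thesis by blast
  next
    case False
    define w where "w = (c - k - (1 - t)) / t"
    have t0: "0 < t" using False k by linarith
    have w: "0 < w" "w \<le> 1" "t * w = c - k - (1 - t)"
      using False k(2) t0 by (simp_all add: w_def)
    have combine: "(1-t) * (real k + 1) + t * (real k + w) = c"
    proof -
      have "(1-t) * (real k + 1) + t * (real k + w) = real k + (1 - t) + t * w"
        by (simp add: algebra_simps)
      then show ?thesis using w(3) by linarith
    qed
    have "c \<le> (1-t) * stairs N 0 x + t * stairs N 2 y \<longleftrightarrow> real k + (2 + w) / 4 \<le> y"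
      if xy: "\<bar>x - y\<bar> \<le> 1/4" for x y
    proof
      assume y: "real k + (2 + w) / 4 \<le> y"
      have "real k + w \<le> stairs N 2 y"
        using stairs_above[of k N 2 w y] k w y by simp
      \<comment> \<open>At \<open>k + 1/4\<close> ramp \<open>k\<close> of the first staircase is
        complete.\<close>
      moreover have "real k + 1 / 4 \<le> x"
        using w(1) y xy unfolding add_divide_distrib by linarith
      then have "real k + 1 \<le> stairs N 0 x"
        using stairs_above[of k N 0 1 x] k by simp
      ultimately have
        "(1-t) * (real k + 1) + t * (real k + w) \<le> (1-t) * stairs N 0 x + t * stairs N 2 y"
        using t by (intro add_mono mult_left_mono) auto
      then show "c \<le> (1-t) * stairs N 0 x + t * stairs N 2 y"
        unfolding combine .
    next
      assume le: "c \<le> (1-t) * stairs N 0 x + t * stairs N 2 y"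
      show "real k + (2 + w) / 4 \<le> y"
      proof (rule ccontr)
        assume y: "\<not> real k + (2 + w) / 4 \<le> y"
        have "stairs N 2 y < real k + w"
          using stairs_below[of k N y 2 w] k w y by simp
        \<comment> \<open>Here \<open>x < k + 1\<close>, where the next ramp of the first staircase
          starts.\<close>
        moreover have "stairs N 0 x \<le> stairs N 0 (real k + 1)"
          using y xy w unfolding add_divide_distrib by (intro stairs_mono) linarith
        moreover have "stairs N 0 (real k + 1) = real k + 1"
          using stairs_add[of k N 1 0] k by simp
        ultimately have
          "(1-t) * stairs N 0 x + t * stairs N 2 y < (1-t) * (real k + 1) + t * (real k + w)"
          using t t0 by (intro add_le_less_mono mult_strict_left_mono mult_left_mono) auto
        then show False
          using le unfolding combine by linarith
      qed
    qed
    moreover have "0 < real k + (2 + w) / 4" "real k + (2 + w) / 4 \<le> real N"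
      using w(1,2) N unfolding add_divide_distrib by linarith+
    ultimately show ?thesis by blast
  qed
qed

text \<open>The superlevel set of \<open>h\<close> is compact, and its least point is the threshold.
  It is nonempty because \<open>h 1 = 1\<close>, and its least point is positive because
  \<open>h 0 = 0 < c\<close>.\<close>

lemma mono_continuous_level:
  fixes h :: "real \<Rightarrow> real"
  assumes "continuous_on {0..1} h" "h 0 = 0" "h 1 = 1"
    and mono: "\<And>x y. \<lbrakk>0 \<le> x; x \<le> y; y \<le> 1\<rbrakk> \<Longrightarrow> h x \<le> h y"
    and c: "c \<in> {0<..1}"
  shows "\<exists>a\<in>{0<..1}. \<forall>x\<in>{0..1}. c \<le> h x \<longleftrightarrow> a \<le> x"
proof -
  define S where "S = {0..1} \<inter> h -` {c..}"
  have "closed S"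
    unfolding S_def by (intro continuous_closed_preimage assms closed_real_atLeastAtMost closed_atLeast)
  moreover have "bounded S"
    by (rule bounded_subset[OF bounded_closed_interval]) (auto simp: S_def)
  ultimately have "compact S"
    by (simp add: compact_eq_bounded_closed)
  moreover have "1 \<in> S" using assms(3) c by (simp add: S_def)
  ultimately obtain a where a: "a \<in> S" "\<forall>x\<in>S. a \<le> x"
    using compact_attains_inf[of S] by blast
  have "a \<noteq> 0" using a(1) c assms(2) by (auto simp: S_def)
  then have "a \<in> {0<..1}" using a(1) by (simp add: S_def)
  moreover have "c \<le> h x \<longleftrightarrow> a \<le> x" if "x \<in> {0..1}" for x
  proof
    assume "c \<le> h x"
    then show "a \<le> x" using a(2) that by (simp add: S_def)
  next
    assume "a \<le> x"
    then have "h a \<le> h x" using a(1) that by (intro mono) (simp_all add: S_def)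
    then show "c \<le> h x" using a(1) by (simp add: S_def)
  qed
  ultimately show ?thesis by blast
qed

section \<open>The homotopy\<close>

definition coarse :: "nat \<Rightarrow> real \<Rightarrow> real \<Rightarrow> real" where
  "coarse N a x = stairs N a (real N * x) / real N"

text \<open>A path from \<open>x\<close> to \<open>y\<close> through \<open>coarse N 0 x\<close> and
  \<open>coarse N 2 y\<close>, with one leg per third of the time interval. Clamping the time of
  each leg gives a single formula, whose continuity needs no gluing.\<close>

definition track :: "nat \<Rightarrow> real \<Rightarrow> real \<Rightarrow> real \<Rightarrow> real" where
  "track N x y t = x + clamp01 (3 * t) * (coarse N 0 x - x)
     + clamp01 (3 * t - 1) * (coarse N 2 y - coarse N 0 x)
     + clamp01 (3 * t - 2) * (y - coarse N 2 y)"

lemma coarse_mono: "x \<le> y \<Longrightarrow> coarse N a x \<le> coarse N a y"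
  unfolding coarse_def by (intro divide_right_mono stairs_mono mult_left_mono) auto

lemma coarse_ends:
  assumes "0 < N" "0 \<le> a" "a \<le> 3"
  shows "coarse N a 0 = 0" "coarse N a 1 = 1"
  using assms by (simp_all add: coarse_def stairs_0 stairs_top)

lemma coarse_bounds:
  assumes "0 < N" "0 \<le> a" "a \<le> 3" "x \<in> {0..1}"
  shows "0 \<le> coarse N a x" "coarse N a x \<le> 1"
  using coarse_mono[of 0 x N a] coarse_mono[of x 1 N a] coarse_ends[of N a] assms by auto

lemma coarse_near:
  assumes "0 < N" "0 \<le> a" "a \<le> 3" "x \<in> {0..1}"
  shows "\<bar>coarse N a x - x\<bar> \<le> 1 / N"
proof -
  have "coarse N a x - x = (stairs N a (N * x) - N * x) / N"
    using assms by (simp add: coarse_def diff_divide_distrib)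
  moreover have "\<bar>stairs N a (N * x) - N * x\<bar> \<le> 1"
    using assms by (intro stairs_near) (auto simp: mult_left_le)
  ultimately show ?thesis
    by (simp add: divide_right_mono)
qed

lemma continuous_on_coarse [continuous_intros]:
  "continuous_on S f \<Longrightarrow> continuous_on S (\<lambda>x. coarse N a (f x))"
  unfolding coarse_def divide_inverse by (intro continuous_intros)

lemma track_phases:
  "t \<le> 1/3 \<Longrightarrow> track N x y t = (1 - clamp01 (3 * t)) * x + clamp01 (3 * t) * coarse N 0 x"
  "1/3 \<le> t \<Longrightarrow> t \<le> 2/3 \<Longrightarrow>
     track N x y t = (1 - clamp01 (3 * t - 1)) * coarse N 0 x + clamp01 (3 * t - 1) * coarse N 2 y"
  "2/3 \<le> t \<Longrightarrow>
     track N x y t = (1 - clamp01 (3 * t - 2)) * coarse N 2 y + clamp01 (3 * t - 2) * y"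
  by (simp_all only: track_def clamp01_simps) (simp_all add: algebra_simps)

lemma track_ends [simp]: "track N x y 0 = x" "track N x y 1 = y"
  by (simp_all add: track_def)

text \<open>The outer legs have length at most \<open>1 / N\<close>. The middle one has length at
  most \<open>3 / N\<close>, as seen by passing from \<open>coarse N 0 x\<close> through
  \<open>x\<close> and \<open>y\<close> to \<open>coarse N 2 y\<close>.\<close>

lemma track_near:
  assumes "0 < N" "x \<in> {0..1}" "y \<in> {0..1}" "\<bar>x - y\<bar> \<le> 1 / N"
  shows "\<bar>track N x y t - x\<bar> \<le> 5 / N"
proof -
  have part: "\<bar>clamp01 u * d\<bar> \<le> e" if "\<bar>d\<bar> \<le> e" for u d e
    using that mult_mono[of "clamp01 u" 1 "\<bar>d\<bar>" e] by (simp add: abs_mult)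
  have a: "\<bar>coarse N 0 x - x\<bar> \<le> 1 / N" and b: "\<bar>coarse N 2 y - y\<bar> \<le> 1 / N"
    using coarse_near assms by auto
  define e where "e = 1 / real N"
  note near = a b assms(4) e_def[symmetric]
  have "\<bar>clamp01 (3 * t) * (coarse N 0 x - x)\<bar> \<le> e"
    "\<bar>clamp01 (3 * t - 1) * (coarse N 2 y - coarse N 0 x)\<bar> \<le> 3 * e"
    "\<bar>clamp01 (3 * t - 2) * (y - coarse N 2 y)\<bar> \<le> e"
    using near by (intro part; linarith)+
  then have "\<bar>track N x y t - x\<bar> \<le> 5 * e"
    unfolding track_def by linarith
  then show ?thesis by (simp add: e_def)
qed

lemma convex_combination_level:
  assumes "0 < N" "0 \<le> a" "a \<le> 3" "0 \<le> t" "t \<le> 1" "c \<in> {0<..1}"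
  shows "\<exists>b\<in>{0<..1}. \<forall>x\<in>{0..1}. c \<le> (1 - t) * x + t * coarse N a x \<longleftrightarrow> b \<le> x"
proof (rule mono_continuous_level)
  show "continuous_on {0..1} (\<lambda>x. (1 - t) * x + t * coarse N a x)"
    by (intro continuous_intros)
next
  fix x y :: real assume "x \<le> y"
  then show "(1 - t) * x + t * coarse N a x \<le> (1 - t) * y + t * coarse N a y"
    using assms by (intro add_mono mult_left_mono coarse_mono) auto
qed (use assms in \<open>simp_all add: coarse_ends\<close>)

text \<open>This is \<open>stairs_combination_level\<close> at the level \<open>N * c\<close>,
  rescaled by \<open>N\<close>: the band \<open>1/4\<close> becomes \<open>1 / (4 * N)\<close> and
  the threshold \<open>a\<close> becomes \<open>a / N\<close>.\<close>

lemma coarse_combination_level: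
  assumes "0 < N" and t: "0 \<le> t" "t \<le> 1" and c: "c \<in> {0<..1}"
  shows "\<exists>a\<in>{0<..1}.
    (\<forall>x\<in>{0..1}. \<forall>y\<in>{0..1}. \<bar>x - y\<bar> \<le> 1 / (4 * real N) \<longrightarrow>
      (c \<le> (1 - t) * coarse N 0 x + t * coarse N 2 y \<longleftrightarrow> a \<le> x)) \<or>
    (\<forall>x\<in>{0..1}. \<forall>y\<in>{0..1}. \<bar>x - y\<bar> \<le> 1 / (4 * real N) \<longrightarrow>
      (c \<le> (1 - t) * coarse N 0 x + t * coarse N 2 y \<longleftrightarrow> a \<le> y))"
proof -
  have N: "0 < real N" using assms by simp
  obtain a where a: "0 < a" "a \<le> real N" and
    lev: "(\<forall>x y. \<bar>x - y\<bar> \<le> 1/4 \<longrightarrow> (N * c \<le> (1-t) * stairs N 0 x + t * stairs N 2 y \<longleftrightarrow> a \<le> x)) \<or>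
     (\<forall>x y. \<bar>x - y\<bar> \<le> 1/4 \<longrightarrow> (N * c \<le> (1-t) * stairs N 0 x + t * stairs N 2 y \<longleftrightarrow> a \<le> y))"
    using stairs_combination_level[of "N * c" N t] c t N by (force simp: mult_left_le)
  have scale: "c \<le> (1 - t) * coarse N 0 x + t * coarse N 2 y \<longleftrightarrow>
      N * c \<le> (1-t) * stairs N 0 (N * x) + t * stairs N 2 (N * y)" for x y :: real
    using N by (simp add: coarse_def field_simps)
  have near: "\<bar>N * x - N * y\<bar> \<le> 1/4" if "\<bar>x - y\<bar> \<le> 1 / (4 * real N)" for x y :: real
  proof -
    have "\<bar>N * x - N * y\<bar> = N * \<bar>x - y\<bar>"
      using N by (simp add: abs_mult flip: right_diff_distrib)
    then show ?thesis
      using that N by (simp add: field_simps)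
  qed
  have thr: "a \<le> N * x \<longleftrightarrow> a / N \<le> x" for x :: real
    using N by (simp add: field_simps)
  have "(\<forall>x y. \<bar>x - y\<bar> \<le> 1 / (4 * real N) \<longrightarrow>
      (c \<le> (1 - t) * coarse N 0 x + t * coarse N 2 y \<longleftrightarrow> a / N \<le> x)) \<or>
    (\<forall>x y. \<bar>x - y\<bar> \<le> 1 / (4 * real N) \<longrightarrow>
      (c \<le> (1 - t) * coarse N 0 x + t * coarse N 2 y \<longleftrightarrow> a / N \<le> y))"
    unfolding scale thr[symmetric] using lev by (rule disj_forward) (use near in blast)+
  moreover have "a / N \<in> {0<..1}" using a N by simp
  ultimately show ?thesis by blast
qed

lemma track_range:
  assumes "0 < N" "x \<in> {0..1}" "y \<in> {0..1}" "t \<in> {0..1}"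
  shows "track N x y t \<in> {0..1}"
proof -
  have conv: "(1 - clamp01 u) * p + clamp01 u * q \<in> {0..1}" if "p \<in> {0..1}" "q \<in> {0..1}" for u p q
    using that convex_bound_le[of p 1 q "1 - clamp01 u" "clamp01 u"] by auto
  have "coarse N 0 x \<in> {0..1}" "coarse N 2 y \<in> {0..1}"
    using coarse_bounds assms by auto
  note range = assms(2,3) this
  consider "t \<le> 1/3" | "1/3 \<le> t" "t \<le> 2/3" | "2/3 \<le> t" by linarith
  then show ?thesis
    by cases (simp_all only: track_phases conv range)
qed

text \<open>In the outer phases the value depends monotonically on one variable alone; in the middle
  phase the two separated staircases decide which variable sets the threshold.\<close>

lemma track_in_realization:
  assumes "partial_order_on P r" "0 < N"
    and "f \<in> geometric_realization P r" "g \<in> geometric_realization P r"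
    and near: "\<forall>s\<in>P. \<bar>f s - g s\<bar> \<le> 1 / (4 * real N)" and t: "t \<in> {0..1}"
  shows "(\<lambda>s\<in>P. track N (f s) (g s) t) \<in> geometric_realization P r"
proof (rule geometric_realization_combine[OF assms(1,3,4) near])
  fix c :: real assume c: "c \<in> {0<..1}"
  consider "t \<le> 1/3" | "1/3 \<le> t" "t \<le> 2/3" | "2/3 \<le> t" by linarith
  then show "\<exists>a\<in>{0<..1}.
      (\<forall>x\<in>{0..1}. \<forall>y\<in>{0..1}. \<bar>x - y\<bar> \<le> 1 / (4 * real N) \<longrightarrow> (c \<le> track N x y t \<longleftrightarrow> a \<le> x)) \<or>
      (\<forall>x\<in>{0..1}. \<forall>y\<in>{0..1}. \<bar>x - y\<bar> \<le> 1 / (4 * real N) \<longrightarrow> (c \<le> track N x y t \<longleftrightarrow> a \<le> y))"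
  proof cases
    case 1
    then show ?thesis
      using convex_combination_level[of N 0 "clamp01 (3 * t)" c] assms(2) c
      by (simp add: track_phases) blast
  next
    case 2
    then show ?thesis
      using coarse_combination_level[of N "clamp01 (3 * t - 1)" c] assms(2) c
      by (simp add: track_phases)
  next
    case 3
    then show ?thesis
      \<comment> \<open>The last leg runs from the staircase to the identity, so the weight of the
        staircase is the complement of the clamped time.\<close>
      using convex_combination_level[of N 2 "1 - clamp01 (3 * t - 2)" c] assms(2) c
      by (simp add: track_phases add.commute) blast
  qed
qed (use track_range assms in blast)

lemma uniformly_continuous_on_track:
  "uniformly_continuous_on ({0..1} \<times> {0..1} \<times> {0..1}) (\<lambda>(x, y, t). track N x y t)"
  unfolding track_def case_prod_beta
  by (intro compact_uniformly_continuous compact_Times continuous_intros) auto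

text \<open>One modulus for the numerical formula serves all coordinates \<open>s\<close> at once;
  this turns coordinatewise estimates into estimates of the supremum distance.\<close>

lemma track_modulus:
  assumes "0 < e"
  obtains d where "0 < d"
    "\<And>x y t x' y' t'. \<lbrakk>{x, y, t, x', y', t'} \<subseteq> {0..1}; \<bar>x - x'\<bar> < d; \<bar>y - y'\<bar> < d; \<bar>t - t'\<bar> < d\<rbrakk>
       \<Longrightarrow> \<bar>track N x y t - track N x' y' t'\<bar> < e"
proof -
  let ?I = "{0..1::real} \<times> {0..1::real} \<times> {0..1::real}"
  obtain d where d: "0 < d" "\<And>u v. \<lbrakk>u \<in> ?I; v \<in> ?I; dist v u < d\<rbrakk> \<Longrightarrow>
      dist (case v of (x, y, t) \<Rightarrow> track N x y t) (case u of (x, y, t) \<Rightarrow> track N x y t) < e"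
    using uniformly_continuous_on_track[of N] assms unfolding uniformly_continuous_on_def by meson
  \<comment> \<open>The product distance is at most the sum of the three coordinate distances, hence
    the factor 3.\<close>
  show ?thesis
  proof (rule that[of "d / 3"])
    fix x y t x' y' t' :: real
    assume I: "{x, y, t, x', y', t'} \<subseteq> {0..1}"
      and small: "\<bar>x - x'\<bar> < d / 3" "\<bar>y - y'\<bar> < d / 3" "\<bar>t - t'\<bar> < d / 3"
    have "dist (x, y, t) (x', y', t') \<le> \<bar>x - x'\<bar> + (\<bar>y - y'\<bar> + \<bar>t - t'\<bar>)"
      unfolding dist_prod_def fst_conv snd_conv dist_real_def
      by (rule order_trans[OF sqrt_sum_squares_le_sum_abs])
        (use sqrt_sum_squares_le_sum_abs[of "y - y'" "t - t'"] in simp)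
    then have "dist (x, y, t) (x', y', t') < d" using small by linarith
    then show "\<bar>track N x y t - track N x' y' t'\<bar> < e"
      using d(2)[of "(x', y', t')" "(x, y, t)"] I by (auto simp: dist_real_def)
  qed (use d in simp)
qed

section \<open>Uniform local contractibility\<close>

lemma sup_dist_component:
  assumes "f \<in> cube P" "g \<in> cube P" "s \<in> P"
  shows "\<bar>f s - g s\<bar> \<le> sup_dist P f g"
  using cSup_upper[OF _ bdd_above_sup_dist[OF assms(1,2)]] assms by (auto simp: sup_dist_def)

lemma sup_dist_le:
  assumes "f \<in> cube P" "g \<in> cube P" "0 \<le> e" "\<And>s. s \<in> P \<Longrightarrow> \<bar>f s - g s\<bar> \<le> e"
  shows "sup_dist P f g \<le> e"
  using assms by (auto simp: sup_dist_def intro!: cSup_least)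

text \<open>The homotopy applies \<open>track N\<close> in every coordinate. The closeness
  \<open>1 / (4 * N)\<close> keeps the pairs \<open>(f x s, g x s)\<close> in the band where the
  staircases are separated.\<close>

lemma close_maps_homotopic_realization:
  assumes po: "partial_order_on P r" and N: "0 < N" "5 / real N \<le> \<epsilon>"
  shows "close_maps_homotopic \<epsilon> (1 / (4 * real N)) X (realization_metric P r)"
  unfolding close_maps_homotopic_def
proof (intro allI impI)
  fix f g
  assume f: "uniformly_continuous_map X (realization_metric P r) f"
    and g: "uniformly_continuous_map X (realization_metric P r) g"
    and close: "\<forall>x\<in>mspace X. mdist (realization_metric P r) (f x) (g x) < 1 / (4 * real N)"
  let ?H = "\<lambda>(x, t). \<lambda>s\<in>P. track N (f x s) (g x s) t"
  have R: "f x \<in> geometric_realization P r" "g x \<in> geometric_realization P r" if "x \<in> mspace X" for x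
    using uniformly_continuous_map_funspace[OF f] uniformly_continuous_map_funspace[OF g] that by auto
  then have cube: "f x \<in> cube P" "g x \<in> cube P" if "x \<in> mspace X" for x
    using that geometric_realization_subset_cube by blast+
  have I: "f x s \<in> {0..1}" "g x s \<in> {0..1}" if "x \<in> mspace X" "s \<in> P" for x s
    using cube[OF that(1)] that(2) unfolding cube_def by (blast dest: PiE_mem)+
  have near: "\<bar>f x s - g x s\<bar> \<le> 1 / (4 * real N)" if "x \<in> mspace X" "s \<in> P" for x s
    using sup_dist_component[OF cube[OF that(1)] that(2)] close that by force
  have H: "?H (x, t) \<in> geometric_realization P r" if "x \<in> mspace X" "t \<in> {0..1}" for x t
    using track_in_realization[OF po N(1) R[OF that(1)] _ that(2)] near that by simp
  then have Hcube: "?H (x, t) \<in> cube P" if "x \<in> mspace X" "t \<in> {0..1}" for x t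
    using that geometric_realization_subset_cube by blast
  have ext: "f x \<in> extensional P" "g x \<in> extensional P" if "x \<in> mspace X" for x
    using cube[OF that] by (auto simp: cube_def PiE_def)
  have ends: "?H (x, 0) = f x \<and> ?H (x, 1) = g x" if "x \<in> mspace X" for x
    using ext[OF that] by (simp add: extensional_restrict cong: restrict_cong)
  let ?I = "submetric euclidean_metric {0..1::real}"
  have "uniformly_continuous_map (prod_metric X ?I) (realization_metric P r) ?H"
    unfolding uniformly_continuous_map_def
  proof (intro conjI allI impI)
    show "?H \<in> mspace (prod_metric X ?I) \<rightarrow> mspace (realization_metric P r)"
      using H by auto
  next
    fix e :: real assume "0 < e"
    \<comment> \<open>Strict bounds in the coordinates give only a weak bound on the supremum, so
      the modulus is taken for \<open>e / 2\<close>.\<close>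
    obtain d where d: "0 < d"
      "\<And>x y t x' y' t'. \<lbrakk>{x, y, t, x', y', t'} \<subseteq> {0..1}; \<bar>x - x'\<bar> < d; \<bar>y - y'\<bar> < d; \<bar>t - t'\<bar> < d\<rbrakk>
         \<Longrightarrow> \<bar>track N x y t - track N x' y' t'\<bar> < e / 2"
      using track_modulus[of "e / 2" N] \<open>0 < e\<close> by auto
    obtain d1 where d1: "0 < d1" "\<And>x y. \<lbrakk>x \<in> mspace X; y \<in> mspace X; mdist X y x < d1\<rbrakk> \<Longrightarrow>
        sup_dist P (f y) (f x) < d"
      using f \<open>0 < d\<close> unfolding uniformly_continuous_map_def mdist_realization_metric by metis
    obtain d2 where d2: "0 < d2" "\<And>x y. \<lbrakk>x \<in> mspace X; y \<in> mspace X; mdist X y x < d2\<rbrakk> \<Longrightarrow>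
        sup_dist P (g y) (g x) < d"
      using g \<open>0 < d\<close> unfolding uniformly_continuous_map_def mdist_realization_metric by metis
    show "\<exists>\<delta>>0. \<forall>u\<in>mspace (prod_metric X ?I). \<forall>v\<in>mspace (prod_metric X ?I).
        mdist (prod_metric X ?I) v u < \<delta> \<longrightarrow> mdist (realization_metric P r) (?H v) (?H u) < e"
    proof (intro exI[of _ "min d (min d1 d2)"] conjI ballI impI)
      fix u v assume uv: "u \<in> mspace (prod_metric X ?I)" "v \<in> mspace (prod_metric X ?I)"
        "mdist (prod_metric X ?I) v u < min d (min d1 d2)"
      obtain x t y t' where xt: "u = (x, t)" "v = (y, t')" by fastforce
      then have m: "x \<in> mspace X" "y \<in> mspace X" "t \<in> {0..1}" "t' \<in> {0..1}"
        using uv by auto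
      have "mdist X y x < min d (min d1 d2)" "dist t' t < min d (min d1 d2)"
        using uv(3) le_less_trans[OF real_sqrt_sum_squares_ge1[of "mdist X y x" "dist t' t"]]
          le_less_trans[OF real_sqrt_sum_squares_ge2[of "dist t' t" "mdist X y x"]]
        by (auto simp only: xt prod_dist_def mdist_prod_metric mdist_submetric mdist_euclidean_metric prod.case)
      then have small: "\<bar>t' - t\<bar> < d" "sup_dist P (f y) (f x) < d" "sup_dist P (g y) (g x) < d"
        using d1 d2 m by (auto simp: dist_real_def)
      have "sup_dist P (?H v) (?H u) \<le> e / 2"
        unfolding xt
      proof (rule sup_dist_le[OF Hcube[OF m(2,4)] Hcube[OF m(1,3)]])
        fix s assume s: "s \<in> P"
        have "\<bar>f y s - f x s\<bar> < d" "\<bar>g y s - g x s\<bar> < d"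
          using sup_dist_component[OF cube(1)[OF m(2)] cube(1)[OF m(1)] s]
            sup_dist_component[OF cube(2)[OF m(2)] cube(2)[OF m(1)] s] small by linarith+
        then have "\<bar>track N (f y s) (g y s) t' - track N (f x s) (g x s) t\<bar> < e / 2"
          using d(2)[of "f y s" "g y s" t' "f x s" "g x s" t] I m s small by auto
        then show "\<bar>?H (y, t') s - ?H (x, t) s\<bar> \<le> e / 2"
          using s by simp
      qed (use \<open>0 < e\<close> in simp)
      then show "mdist (realization_metric P r) (?H v) (?H u) < e"
        using \<open>0 < e\<close> unfolding mdist_realization_metric by linarith
    qed (use d d1 d2 in simp)
  qed
  moreover have "sup_dist P (?H (x, t)) (?H (x, 0)) \<le> \<epsilon>" if x: "x \<in> mspace X" "t \<in> {0..1}" for x t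
  proof (rule sup_dist_le[OF Hcube[OF x] Hcube[OF x(1)]])
    fix s assume s: "s \<in> P"
    have "1 / (4 * real N) \<le> 1 / real N"
      using N by (simp add: field_simps)
    then have "\<bar>track N (f x s) (g x s) t - f x s\<bar> \<le> 5 / N"
      using track_near[of N "f x s" "g x s" t] near[OF x(1) s] I[OF x(1) s] N by linarith
    then show "\<bar>?H (x, t) s - ?H (x, 0) s\<bar> \<le> \<epsilon>"
      using s N by simp
  next
    have "0 \<le> 5 / real N" by simp
    then show "0 \<le> \<epsilon>" using N by linarith
  qed simp
  ultimately show "uniformly_homotopic \<epsilon> X (realization_metric P r) f g"
    unfolding uniformly_homotopic_def mdist_realization_metric using ends
    by (intro exI[of _ ?H] conjI) blast+
qed

text \<open>
  Two close maps \<open>f\<close> and \<open>g\<close> are the pullback, along \<open>x \<mapsto> (f x, g x)\<close>, of the two coordinate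
  projections on the space of close pairs.
\<close>

lemma close_maps_homotopic_from_pairs:
  fixes X :: "'x metric" and Y :: "'y metric"
  assumes pairs: "\<And>Z :: ('y \<times> 'y) metric. close_maps_homotopic \<epsilon> \<delta> Z Y"
  shows "close_maps_homotopic \<epsilon> \<delta> X Y"
  unfolding close_maps_homotopic_def
proof (intro allI impI)
  fix f g
  assume f: "uniformly_continuous_map X Y f" and g: "uniformly_continuous_map X Y g"
    and close: "\<forall>x\<in>mspace X. mdist Y (f x) (g x) < \<delta>"
  let ?Z = "submetric (prod_metric Y Y) {(u, v). mdist Y u v < \<delta>}"
  let ?I = "submetric euclidean_metric {0..1::real}"
  let ?h = "\<lambda>x. (f x, g x)"
  have h: "uniformly_continuous_map X ?Z ?h"
    using f g close
    by (auto simp: uniformly_continuous_map_into_submetric uniformly_continuous_map_pairwise o_def)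
  have "uniformly_continuous_map ?Z Y fst" "uniformly_continuous_map ?Z Y snd"
    by (intro uniformly_continuous_map_from_submetric Lipschitz_imp_uniformly_continuous_map
        Lipschitz_continuous_map_projections)+
  moreover have "\<forall>z\<in>mspace ?Z. mdist Y (fst z) (snd z) < \<delta>" by auto
  ultimately obtain K where K: "uniformly_continuous_map (prod_metric ?Z ?I) Y K"
    "\<forall>z\<in>mspace ?Z. K (z, 0) = fst z \<and> K (z, 1) = snd z"
    "\<forall>z\<in>mspace ?Z. \<forall>t\<in>{0..1}. mdist Y (K (z, t)) (K (z, 0)) \<le> \<epsilon>"
    using pairs[of ?Z] unfolding close_maps_homotopic_def uniformly_homotopic_def by blast
  \<comment> \<open>The homotopy \<open>K\<close> between the projections is pulled back along
    \<open>(x, t) \<mapsto> ((f x, g x), t)\<close>.\<close>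
  let ?k = "\<lambda>p. (?h (fst p), snd p)"
  have "uniformly_continuous_map (prod_metric X ?I) X fst"
    "uniformly_continuous_map (prod_metric X ?I) ?I snd"
    by (intro Lipschitz_imp_uniformly_continuous_map Lipschitz_continuous_map_projections)+
  then have "uniformly_continuous_map (prod_metric X ?I) (prod_metric ?Z ?I) ?k"
    using uniformly_continuous_map_compose[OF _ h]
    unfolding uniformly_continuous_map_pairwise o_def fst_conv snd_conv by blast
  then have "uniformly_continuous_map (prod_metric X ?I) Y (K \<circ> ?k)"
    using K(1) uniformly_continuous_map_compose by blast
  moreover have "?h x \<in> mspace ?Z" if "x \<in> mspace X" for x
    using uniformly_continuous_map_funspace[OF h] that by blast
  then have "\<forall>x\<in>mspace X. K (?h x, 0) = f x \<and> K (?h x, 1) = g x"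
    "\<forall>x\<in>mspace X. \<forall>t\<in>{0..1}. mdist Y (K (?h x, t)) (K (?h x, 0)) \<le> \<epsilon>"
    using K(2,3) by fastforce+
  ultimately show "uniformly_homotopic \<epsilon> X Y f g"
    unfolding uniformly_homotopic_def by (intro exI[of _ "K \<circ> ?k"]) (simp only: o_def fst_conv snd_conv)
qed

theorem theorem2:
  fixes P :: "'a set" and r :: "('a \<times> 'a) set"
  assumes "partial_order_on P r" and "countable P"
  shows "(\<forall>\<epsilon>>0. \<exists>\<delta>>0. \<forall>X :: 'x metric.
            close_maps_homotopic \<epsilon> \<delta> X (realization_metric P r))
       \<and> (\<forall>\<epsilon>>0. \<forall>\<delta>>0.
            (\<forall>X :: (('a \<Rightarrow> real) \<times> ('a \<Rightarrow> real)) metric.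
               close_maps_homotopic \<epsilon> \<delta> X (realization_metric P r)) \<longrightarrow>
            (\<forall>X :: 'x metric. close_maps_homotopic \<epsilon> \<delta> X (realization_metric P r)))"
proof (intro conjI allI impI)
  fix \<epsilon> :: real assume "0 < \<epsilon>"
  \<comment> \<open>The homotopy moves points by at most \<open>5 / N\<close>, so
    \<open>N > 5 / \<epsilon>\<close> suffices. The resulting \<open>\<delta> = 1 / (4 * N)\<close>
    depends on \<open>\<epsilon>\<close> alone.\<close>
  obtain N :: nat where "5 / \<epsilon> < N" using reals_Archimedean2 by blast
  moreover have "0 < 5 / \<epsilon>" using \<open>0 < \<epsilon>\<close> by simp
  ultimately have "0 < real N" by linarith
  with \<open>5 / \<epsilon> < N\<close> have N: "0 < real N" "5 / real N \<le> \<epsilon>"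
    using \<open>0 < \<epsilon>\<close> by (simp_all add: field_simps)
  have "close_maps_homotopic \<epsilon> (1 / (4 * real N)) X (realization_metric P r)" for X :: "'x metric"
    using N by (intro close_maps_homotopic_realization assms) simp_all
  moreover have "0 < 1 / (4 * real N)" using N by simp
  ultimately show "\<exists>\<delta>>0. \<forall>X :: 'x metric. close_maps_homotopic \<epsilon> \<delta> X (realization_metric P r)"
    by (intro exI conjI allI)
qed (use close_maps_homotopic_from_pairs in blast)

end
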